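(* Let $\alpha,\gamma\in\mathbb{C}$ and $\Delta\in\mathbb{C}^*$. There are nontrivial extensions of conformal $\mathcal{R}$-modules of the form $$0\longrightarrow V(\alpha,\Delta)\longrightarrow E\longrightarrow \mathbb{C}c_\gamma\longrightarrow 0$$ if and only if $\alpha+\gamma=0$ and $\Delta=1$. In this case, $\dim_{\mathbb{C}}\mathrm{Ext}\big(\mathbb{C}c_{-\alpha},V(\alpha,1)\big)=1$, and the unique (up to a scalar) nontrivial extension is given, on the vector space $E=V(\alpha,1)\oplus\mathbb{C}c_\gamma$ with $V(\alpha,1)=\mathbb{C}[\partial]v_\Delta$ an $\mathcal{R}$-submodule, by $$L_\lambda c_\gamma=c\,v_\Delta,\qquad I_\lambda c_\gamma=0,\qquad \partial c_\gamma=\gamma c_\gamma+c\,v_\Delta,$$ where $c\in\mathbb{C}^*$.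
   Context: $\mathcal{R}=\mathbb{C}[\partial]L\oplus\mathbb{C}[\partial]I$ is the Lie conformal algebra, free of rank $2$ over $\mathbb{C}[\partial]$, with $[L_\lambda L]=(\partial+2\lambda)(L+I)$, $[L_\lambda I]=(\partial+\lambda)I$, $[I_\lambda L]=\lambda I$, $[I_\lambda I]=0$. A conformal module $V$ over $\mathcal{R}$ is a $\mathbb{C}[\partial]$-module with a $\mathbb{C}$-linear map $\mathcal{R}\to \mathrm{End}_{\mathbb{C}}(V)\otimes\mathbb{C}[\lambda]$, $a\mapsto a_\lambda$, such that $a_\lambda b_\mu-b_\mu a_\lambda=[a_\lambda b]_{\lambda+\mu}$ and $(\partial a)_\lambda=[\partial,a_\lambda]=-\lambda a_\lambda$ (so $a_\lambda(\partial v)=(\partial+\lambda)a_\lambda v$). $V(\alpha,\Delta)=\mathbb{C}[\partial]v_\Delta$ is the module free of rank one over $\mathbb{C}[\partial]$ with $L_\lambda v_\Delta=(\partial+\alpha+\Delta\lambda)v_\Delta$, $I_\lambda v_\Delta=0$. $\mathbb{C}c_\gamma$ is the $1$-dimensional module with $L_\lambda c_\gamma=I_\lambda c_\gamma=0$, $\partial c_\gamma=\gamma c_\gamma$. An extension of $W$ by $V$ is an exact sequence of $\mathcal{R}$-modules $0\to V\to E\to W\to 0$. Two extensions $E,E'$ of $W$ by $V$ are equivalent if there is a module homomorphism $\psi:E\to E'$ compatible with the identity maps of $V$ and $W$. An extension is trivial if it is equivalent to the direct sum $V\oplus W$. Writing $E=V\oplus W$ as a vector space, an extension is described by a cocycle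 (the $V$-valued correction to the action of $\mathcal{R}$ and $\partial$ on $W$); cocycles form a vector space, coboundaries are the cocycles of trivial extensions, and $\mathrm{Ext}(W,V)$ is the quotient of the space of cocycles by the subspace of coboundaries. Uniqueness of the extension is understood up to equivalence. *)

theory Defs
  imports
    Complex_Main
    "HOL-Computational_Algebra.Polynomial"
    "HOL-Library.Function_Algebras"
    "HOL-Library.Product_Plus"
begin

section \<open>The Lie conformal algebra\<close>

text \<open>
  The pair \<open>(p, q)\<close> stands for \<open>p(\<partial>) L + q(\<partial>) I\<close>.

  Throughout, the indeterminates \<open>\<lambda>\<close>, \<open>\<mu>\<close> range over the complex numbers: an element of
  \<open>V[\<lambda>]\<close> is given by the corresponding \<open>V\<close>-valued polynomial function of \<open>\<lambda>\<close>, and identities in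
  \<open>V[\<lambda>]\<close> and \<open>V[\<lambda>, \<mu>]\<close> are identities of such functions.  Nothing is lost, since the field of
  complex numbers is infinite.
\<close>

type_synonym lca = "complex poly \<times> complex poly"

definition genL :: lca where "genL = (1, 0)"

definition genI :: lca where "genI = (0, 1)"

definition lca_scale :: "complex \<Rightarrow> lca \<Rightarrow> lca" where
  "lca_scale z a = (smult z (fst a), smult z (snd a))"

definition lca_der :: "lca \<Rightarrow> lca" where
  "lca_der a = ([:0, 1:] * fst a, [:0, 1:] * snd a)"

text \<open>
  The \<open>\<lambda>\<close>-bracket.  It is the sesquilinear extension
  \<open>[p(\<partial>)x\<^sub>\<lambda> r(\<partial>)y] = p(-\<lambda>) r(\<partial>+\<lambda>) [x\<^sub>\<lambda> y]\<close> of its values on the generators, which are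
  recovered in the lemmas below.
\<close>

definition lca_bracket :: "complex \<Rightarrow> lca \<Rightarrow> lca \<Rightarrow> lca" where
  "lca_bracket l a b =
    (let p = poly (fst a) (- l);         q = poly (snd a) (- l);
         r = pcompose (fst b) [:l, 1:];  s = pcompose (snd b) [:l, 1:]
     in (smult p (r * [:2 * l, 1:]),
         smult p (r * [:2 * l, 1:]) + smult p (s * [:l, 1:]) + smult q (r * [:l:])))"

lemma lca_bracket_generators:
  "lca_bracket l genL genL = lca_der (genL + genI) + lca_scale (2 * l) (genL + genI)"
  "lca_bracket l genL genI = lca_der genI + lca_scale l genI"
  "lca_bracket l genI genL = lca_scale l genI"
  "lca_bracket l genI genI = 0"
  by (simp_all add: lca_bracket_def genL_def genI_def lca_der_def lca_scale_def pcompose_1 one_pCons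
      zero_prod_def)

lemma lca_bracket_sesquilinear:
  "lca_bracket l (lca_der a) b = lca_scale (- l) (lca_bracket l a b)"
  "lca_bracket l a (lca_der b) = lca_der (lca_bracket l a b) + lca_scale l (lca_bracket l a b)"
  by (simp_all add: lca_bracket_def lca_der_def lca_scale_def Let_def pcompose_mult pcompose_pCons
      algebra_simps smult_add_right)


section \<open>Conformal modules\<close>

text \<open>
  \<open>lact M l a v\<close> is \<open>a\<^sub>\<lambda> v\<close> at \<open>\<lambda> = l\<close>.  A \<open>\<complex>[\<partial>]\<close>-module is a complex vector space with a linear
  endomorphism \<open>\<partial>\<close>.
\<close>

record 'v cmod =
  scl :: "complex \<Rightarrow> 'v \<Rightarrow> 'v"
  der :: "'v \<Rightarrow> 'v"
  lact :: "complex \<Rightarrow> lca \<Rightarrow> 'v \<Rightarrow> 'v"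

text \<open>
  Polynomiality in \<open>\<lambda>\<close> is required for each \<open>a\<close> and \<open>v\<close> separately, that is \<open>a\<^sub>\<lambda> v \<in> V[\<lambda>]\<close>, with no
  bound on the degree uniform in \<open>v\<close>: on a free module the degree of \<open>L\<^sub>\<lambda> \<partial>\<^sup>k v\<close> grows with \<open>k\<close>.
\<close>

definition conformal_module :: "'v::ab_group_add cmod \<Rightarrow> bool" where
  "conformal_module M \<longleftrightarrow>
     vector_space (scl M) \<and>
     Vector_Spaces.linear (scl M) (scl M) (der M) \<and>
     (\<forall>l a. Vector_Spaces.linear (scl M) (scl M) (lact M l a)) \<and>
     (\<forall>l v. Vector_Spaces.linear lca_scale (scl M) (\<lambda>a. lact M l a v)) \<and>
     (\<forall>a v. \<exists>N w. \<forall>l. lact M l a v = (\<Sum>n\<le>N. scl M (l ^ n) (w n))) \<and>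
     (\<forall>l m a b v. lact M l a (lact M m b v) - lact M m b (lact M l a v)
                  = lact M (l + m) (lca_bracket l a b) v) \<and>
     (\<forall>l a v. lact M l (lca_der a) v = scl M (- l) (lact M l a v)) \<and>
     (\<forall>l a v. der M (lact M l a v) - lact M l a (der M v) = scl M (- l) (lact M l a v))"

definition cmod_hom :: "'v::ab_group_add cmod \<Rightarrow> 'w::ab_group_add cmod \<Rightarrow> ('v \<Rightarrow> 'w) \<Rightarrow> bool" where
  "cmod_hom M N f \<longleftrightarrow>
     Vector_Spaces.linear (scl M) (scl N) f \<and>
     (\<forall>v. f (der M v) = der N (f v)) \<and>
     (\<forall>l a v. f (lact M l a v) = lact N l a (f v))"

text \<open>
  \<open>V(\<alpha>,\<Delta>)\<close>, with \<open>f(\<partial>) v\<^sub>\<Delta>\<close> represented by \<open>f\<close>, so that \<open>v\<^sub>\<Delta>\<close> is \<open>1\<close>.  The action is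
  \<open>(p(\<partial>)L + q(\<partial>)I)\<^sub>\<lambda> f(\<partial>)v\<^sub>\<Delta> = p(-\<lambda>) f(\<partial>+\<lambda>) (\<partial> + \<alpha> + \<Delta>\<lambda>) v\<^sub>\<Delta>\<close>.
\<close>

definition Vmod :: "complex \<Rightarrow> complex \<Rightarrow> complex poly cmod" where
  "Vmod \<alpha> \<Delta> =
     \<lparr>scl = smult,
      der = (\<lambda>f. [:0, 1:] * f),
      lact = (\<lambda>l a f. smult (poly (fst a) (- l)) (pcompose f [:l, 1:] * [:\<alpha> + \<Delta> * l, 1:]))\<rparr>"

text \<open>The one-dimensional module \<open>\<complex>c\<^sub>\<gamma>\<close>, with \<open>c\<^sub>\<gamma>\<close> represented by \<open>1\<close>.\<close>

definition Cmod :: "complex \<Rightarrow> complex cmod" where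
  "Cmod \<gamma> = \<lparr>scl = (*), der = (\<lambda>z. \<gamma> * z), lact = (\<lambda>_ _ _. 0)\<rparr>"

lemma linear_from_vector_space:
  fixes f :: "'a::ab_group_add \<Rightarrow> 'b::ab_group_add"
  assumes "vector_space s" "vector_space t"
    and "\<And>x y. f (x + y) = f x + f y" "\<And>c x. f (s c x) = t c (f x)"
  shows "Vector_Spaces.linear s t f"
  using assms
  by (simp add: Vector_Spaces.linear_def module_hom_def module_hom_axioms_def
      vector_space_def module_def)

lemma vector_space_smult: "vector_space (smult :: complex \<Rightarrow> complex poly \<Rightarrow> complex poly)"
  by unfold_locales (simp_all add: smult_add_left smult_add_right)

lemma vector_space_lca: "vector_space lca_scale"
  by unfold_locales (simp_all add: lca_scale_def smult_add_left smult_add_right)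

lemma conformal_module_Cmod: "conformal_module (Cmod \<gamma>)"
proof -
  have vs: "vector_space ((*) :: complex \<Rightarrow> complex \<Rightarrow> complex)"
    by unfold_locales (simp_all add: algebra_simps)
  show ?thesis
    unfolding conformal_module_def Cmod_def
    by (auto intro!: linear_from_vector_space vs vector_space_lca exI[of _ 0] exI[of _ "\<lambda>_. 0"]
        simp: algebra_simps)
qed

lemma polynomial_in_parameter:
  fixes f :: "complex poly"
  shows "\<exists>Q. \<forall>l. smult (poly p (- l)) (pcompose f [:l, 1:] * [:\<alpha> + \<Delta> * l, 1:]) = poly Q [:l:]"
proof -
  have "\<exists>Q. \<forall>l. [:poly p (- l):] = poly Q [:l:]"
  proof (induction p)
    case 0
    show ?case by (rule exI[of _ 0]) simp
  next
    case (pCons c p)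
    then obtain Q where Q: "\<And>l. [:poly p (- l):] = poly Q [:l:]" by blast
    show ?case
      by (rule exI[of _ "[:[:c:]:] + [:0, - 1:] * Q"])
        (simp add: Q[symmetric])
  qed
  then obtain Q where Q: "\<And>l. [:poly p (- l):] = poly Q [:l:]" by blast
  have "\<exists>R. \<forall>l. pcompose f [:l, 1:] = poly R [:l:]"
  proof (induction f)
    case 0
    show ?case by (rule exI[of _ 0]) simp
  next
    case (pCons c f)
    then obtain R where R: "\<And>l. pcompose f [:l, 1:] = poly R [:l:]" by blast
    show ?case
      by (rule exI[of _ "[:[:c:]:] + [:[:0, 1:], 1:] * R"])
        (simp add: R[symmetric] pcompose_pCons algebra_simps)
  qed
  then obtain R where R: "\<And>l. pcompose f [:l, 1:] = poly R [:l:]" by blast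
  have "smult (poly p (- l)) (pcompose f [:l, 1:] * [:\<alpha> + \<Delta> * l, 1:])
      = poly (Q * (R * [:[:\<alpha>, 1:], [:\<Delta>:]:])) [:l:]" for l
    by (simp add: Q[symmetric] R[symmetric] mult.commute smult_add_left add_ac)
  then show ?thesis by blast
qed

lemma poly_eq_smult_sum:
  fixes Q :: "complex poly poly"
  shows "poly Q [:l:] = (\<Sum>n\<le>degree Q. smult (l ^ n) (coeff Q n))"
  by (simp add: poly_altdef poly_const_pow mult.commute)

lemma conformal_module_Vmod: "conformal_module (Vmod \<alpha> \<Delta>)"
proof -
  let ?A = "\<lambda>l (a::lca) f. smult (poly (fst a) (- l)) (pcompose f [:l, 1:] * [:\<alpha> + \<Delta> * l, 1:])"
  have pol: "\<exists>N w. \<forall>l. ?A l a f = (\<Sum>n\<le>N. smult (l ^ n) (w n))" for a f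
    using polynomial_in_parameter[of "fst a" f \<alpha> \<Delta>] poly_eq_smult_sum by metis
  have br: "?A l a (?A m b f) - ?A m b (?A l a f) = ?A (l + m) (lca_bracket l a b) f" for l m a b f
  proof -
    have "poly (?A l a (?A m b f) - ?A m b (?A l a f)) x
        = poly (?A (l + m) (lca_bracket l a b) f) x" for x
    proof -
      have 1: "m + (l + x) = x + (l + m)" "l + (m + x) = x + (l + m)" "l + (- l - m) = - m"
        "l + m + x = x + (l + m)"
        by simp_all
      show ?thesis
        by (simp add: lca_bracket_def Let_def poly_pcompose 1, algebra)
    qed
    then show ?thesis by (intro poly_eq_poly_eq_iff[THEN iffD1] ext)
  qed
  have lin: "?A l a (f + g) = ?A l a f + ?A l a g" "?A l a (smult z f) = smult z (?A l a f)"
    "?A l (a + b) f = ?A l a f + ?A l b f" "?A l (lca_scale z a) f = smult z (?A l a f)" for l a b f g z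
    by (simp_all only: fst_add poly_add smult_add_left smult_add_right pcompose_add pcompose_smult
        distrib_right lca_scale_def fst_conv poly_smult smult_smult mult_smult_left mult.commute[of _ z])
  have der: "?A l (lca_der a) f = smult (- l) (?A l a f)" for l a f
    by (simp add: lca_der_def)
  have com: "[:0, 1:] * ?A l a f - ?A l a ([:0, 1:] * f) = smult (- l) (?A l a f)" for l a f
  proof -
    have eq: "[:0, 1:] * X - [:l, 1:] * X = smult (- l) X" for X :: "complex poly"
      by (simp only: left_diff_distrib[symmetric]) simp
    have "?A l a ([:0, 1:] * f) = [:l, 1:] * ?A l a f"
    proof -
      have "pcompose [:0, 1:] [:l, 1:] = [:l, 1:]" by (simp add: pcompose_pCons)
      then show ?thesis by (simp only: pcompose_mult mult_smult_right mult.assoc)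
    qed
    then show ?thesis by (simp only: eq)
  qed
  show ?thesis
    unfolding conformal_module_def Vmod_def cmod.simps
  proof (intro conjI allI)
    show "Vector_Spaces.linear smult smult ((*) [:0, 1 :: complex:])"
      by (intro linear_from_vector_space vector_space_smult) (simp_all only: distrib_left mult_smult_right)
    show "Vector_Spaces.linear smult smult (?A l a)" for l a
      by (intro linear_from_vector_space vector_space_smult lin)
    show "Vector_Spaces.linear lca_scale smult (\<lambda>a. ?A l a f)" for l f
      by (intro linear_from_vector_space vector_space_smult vector_space_lca lin)
    show "vector_space (smult :: complex \<Rightarrow> _)" by (rule vector_space_smult)
    show "\<exists>N w. \<forall>l. ?A l a f = (\<Sum>n\<le>N. smult (l ^ n) (w n))" for a f by (rule pol)
    show "?A l a (?A m b f) - ?A m b (?A l a f) = ?A (l + m) (lca_bracket l a b) f" for l m a b f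
      by (rule br)
    show "?A l (lca_der a) f = smult (- l) (?A l a f)" for l a f by (rule der)
    show "[:0, 1:] * ?A l a f - ?A l a ([:0, 1:] * f) = smult (- l) (?A l a f)" for l a f by (rule com)
  qed
qed


section \<open>Extensions\<close>

definition is_extension ::
  "'v::ab_group_add cmod \<Rightarrow> 'e::ab_group_add cmod \<Rightarrow> 'w::ab_group_add cmod \<Rightarrow>
   ('v \<Rightarrow> 'e) \<Rightarrow> ('e \<Rightarrow> 'w) \<Rightarrow> bool" where
  "is_extension V E W i p \<longleftrightarrow>
     conformal_module V \<and> conformal_module E \<and> conformal_module W \<and>
     cmod_hom V E i \<and> cmod_hom E W p \<and>
     inj i \<and> range i = {e. p e = 0} \<and> surj p"

definition ext_equiv ::
  "'e::ab_group_add cmod \<Rightarrow> ('v \<Rightarrow> 'e) \<Rightarrow> ('e \<Rightarrow> 'w) \<Rightarrow>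
   'f::ab_group_add cmod \<Rightarrow> ('v \<Rightarrow> 'f) \<Rightarrow> ('f \<Rightarrow> 'w) \<Rightarrow> bool" where
  "ext_equiv E i p E' i' p' \<longleftrightarrow> (\<exists>\<psi>. cmod_hom E E' \<psi> \<and> \<psi> \<circ> i = i' \<and> p' \<circ> \<psi> = p)"

definition incl :: "'v \<Rightarrow> 'v \<times> 'w::zero" where
  "incl v = (v, 0)"

definition direct_sum :: "'v cmod \<Rightarrow> 'w cmod \<Rightarrow> ('v \<times> 'w) cmod" where
  "direct_sum V W =
     \<lparr>scl = (\<lambda>z (v, w). (scl V z v, scl W z w)),
      der = (\<lambda>(v, w). (der V v, der W w)),
      lact = (\<lambda>l a (v, w). (lact V l a v, lact W l a w))\<rparr>"

definition trivial_ext ::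
  "'v::ab_group_add cmod \<Rightarrow> 'e::ab_group_add cmod \<Rightarrow> 'w::ab_group_add cmod \<Rightarrow>
   ('v \<Rightarrow> 'e) \<Rightarrow> ('e \<Rightarrow> 'w) \<Rightarrow> bool" where
  "trivial_ext V E W i p \<longleftrightarrow> ext_equiv E i p (direct_sum V W) incl snd"


section \<open>Cocycles and Ext\<close>

text \<open>
  A cochain consists of the \<open>V\<close>-valued corrections to the action of the algebra and of \<open>\<partial>\<close> on \<open>W\<close>.
\<close>

type_synonym ('v, 'w) cochain = "(complex \<Rightarrow> lca \<Rightarrow> 'w \<Rightarrow> 'v) \<times> ('w \<Rightarrow> 'v)"

definition cochain_scale :: "'v cmod \<Rightarrow> complex \<Rightarrow> ('v, 'w) cochain \<Rightarrow> ('v, 'w) cochain" where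
  "cochain_scale V z \<omega> = ((\<lambda>l a w. scl V z (fst \<omega> l a w)), (\<lambda>w. scl V z (snd \<omega> w)))"

definition twisted_sum ::
  "'v::ab_group_add cmod \<Rightarrow> 'w cmod \<Rightarrow> ('v, 'w) cochain \<Rightarrow> ('v \<times> 'w) cmod" where
  "twisted_sum V W \<omega> =
     \<lparr>scl = (\<lambda>z (v, w). (scl V z v, scl W z w)),
      der = (\<lambda>(v, w). (der V v + snd \<omega> w, der W w)),
      lact = (\<lambda>l a (v, w). (lact V l a v + fst \<omega> l a w, lact W l a w))\<rparr>"

definition cocycles ::
  "'w::ab_group_add cmod \<Rightarrow> 'v::ab_group_add cmod \<Rightarrow> ('v, 'w) cochain set" where
  "cocycles W V = {\<omega>. is_extension V (twisted_sum V W \<omega>) W incl snd}"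

definition coboundaries ::
  "'w::ab_group_add cmod \<Rightarrow> 'v::ab_group_add cmod \<Rightarrow> ('v, 'w) cochain set" where
  "coboundaries W V = {\<omega> \<in> cocycles W V. trivial_ext V (twisted_sum V W \<omega>) W incl snd}"

definition quot_rel :: "'a::ab_group_add set \<Rightarrow> 'a set \<Rightarrow> ('a \<times> 'a) set" where
  "quot_rel Z B = {(x, y). x \<in> Z \<and> y \<in> Z \<and> x - y \<in> B}"

text \<open>
  \<open>B \<subseteq> Z\<close> are subspaces and the quotient space \<open>Z / B\<close> has dimension \<open>n\<close>: there are
  \<open>e\<^sub>0, \<dots>, e\<^sub>n\<^sub>-\<^sub>1\<close> in \<open>Z\<close> whose classes form a basis, i.e. every class is the class of a unique linear
  combination of them.
\<close>

definition quot_dim ::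
  "(complex \<Rightarrow> 'a::ab_group_add \<Rightarrow> 'a) \<Rightarrow> 'a set \<Rightarrow> 'a set \<Rightarrow> nat \<Rightarrow> bool" where
  "quot_dim s Z B n \<longleftrightarrow>
     vector_space s \<and> module.subspace s Z \<and> module.subspace s B \<and> B \<subseteq> Z \<and>
     (\<exists>e :: nat \<Rightarrow> 'a. (\<forall>i<n. e i \<in> Z) \<and>
        (\<forall>\<xi> \<in> Z // quot_rel Z B. \<exists>!u :: nat \<Rightarrow> complex.
            (\<forall>i\<ge>n. u i = 0) \<and> \<xi> = quot_rel Z B `` {\<Sum>i<n. s (u i) (e i)}))"

definition Ext_dim :: "'w::ab_group_add cmod \<Rightarrow> 'v::ab_group_add cmod \<Rightarrow> nat \<Rightarrow> bool" where
  "Ext_dim W V n \<longleftrightarrow> quot_dim (cochain_scale V) (cocycles W V) (coboundaries W V) n"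

text \<open>
  The structure on \<open>E = V(\<alpha>,\<Delta>) \<oplus> \<complex>c\<^sub>\<gamma>\<close> with \<open>L\<^sub>\<lambda> c\<^sub>\<gamma> = c v\<^sub>\<Delta>\<close>, \<open>I\<^sub>\<lambda> c\<^sub>\<gamma> = 0\<close> and
  \<open>\<partial> c\<^sub>\<gamma> = \<gamma> c\<^sub>\<gamma> + c v\<^sub>\<Delta>\<close>; hence \<open>(p(\<partial>)L + q(\<partial>)I)\<^sub>\<lambda> c\<^sub>\<gamma> = p(-\<lambda>) c v\<^sub>\<Delta>\<close>.
  It is a conformal module only under conditions on the parameters.
\<close>

definition Emod :: "complex \<Rightarrow> complex \<Rightarrow> complex \<Rightarrow> complex \<Rightarrow> (complex poly \<times> complex) cmod" where
  "Emod \<alpha> \<Delta> \<gamma> c =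
     twisted_sum (Vmod \<alpha> \<Delta>) (Cmod \<gamma>)
       ((\<lambda>l a z. [:poly (fst a) (- l) * z * c:]), (\<lambda>z. [:z * c:]))"

end

theory Submission
  imports Defs
begin

text \<open>
  In an extension \<open>E\<close>, lift \<open>c\<^sub>\<gamma>\<close> to an element \<open>c\<close>, so that \<open>\<partial>c = \<gamma>c + g(\<partial>)v\<close> and
  \<open>a\<^sub>\<lambda> c = F(\<partial>)v\<close> with \<open>F\<close> depending on \<open>a\<close> and \<open>\<lambda>\<close>.  The identity \<open>a\<^sub>\<lambda> \<partial> = (\<partial> + \<lambda>) a\<^sub>\<lambda>\<close>, applied
  to \<open>c\<close> for \<open>a = p(\<partial>)L + q(\<partial>)I\<close>, reads
  \<open>(\<partial> + \<lambda> - \<gamma>) F(\<partial>) = p(-\<lambda>) g(\<partial> + \<lambda>) (\<partial> + \<alpha> + \<Delta>\<lambda>)\<close>.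
  It determines the action on \<open>c\<close> from \<open>g\<close> alone.
  For \<open>a = L\<close> at \<open>\<partial> = \<gamma> - \<lambda>\<close> it gives \<open>g(\<gamma>) (\<gamma> + \<alpha> + (\<Delta> - 1)\<lambda>) = 0\<close> for every \<open>\<lambda>\<close>: either
  \<open>g(\<gamma>) = 0\<close>, or \<open>\<alpha> + \<gamma> = 0\<close> and \<open>\<Delta> = 1\<close>.  Replacing \<open>c\<close> by \<open>c - h(\<partial>)v\<close> subtracts \<open>(\<partial> - \<gamma>)h\<close>
  from \<open>g\<close>, so division with remainder reduces \<open>g\<close> to the constant \<open>k = g(\<gamma>)\<close>
  (\<open>extension_lift\<close>), and \<open>E\<close> is equivalent to the standard extension with scalar \<open>k\<close>
  (\<open>extension_equiv_Emod\<close>), which is the direct sum if \<open>k = 0\<close>.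

  The remaining scalar is an invariant: for \<open>\<Delta> = 1\<close> and \<open>\<gamma> = -\<alpha>\<close>, change of the lift does not affect
  \<open>g(\<gamma>)\<close>.  Hence the cocycles are parametrised by \<open>k\<close> and \<open>h\<close>, the coboundaries are those with
  \<open>k = 0\<close>, and \<open>Ext\<close> is one-dimensional (\<open>cocycles_eq\<close>, \<open>coboundaries_eq\<close>, \<open>ext_cocycle_inject\<close>).

  The nontrivial extension has a conceptual origin.  By \<open>v\<^sub>1 \<mapsto> (\<partial> + \<alpha>)v\<^sub>0\<close> the module \<open>V(\<alpha>,1)\<close> embeds
  in \<open>V(\<alpha>,0)\<close>, with quotient \<open>\<complex>c\<^sub>-\<^sub>\<alpha>\<close>.  The generator \<open>v\<^sub>0\<close> lifts \<open>c\<^sub>-\<^sub>\<alpha>\<close>, and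
  \<open>\<partial>v\<^sub>0 = -\<alpha>v\<^sub>0 + v\<^sub>1\<close>, \<open>L\<^sub>\<lambda> v\<^sub>0 = v\<^sub>1\<close>: this is the standard extension with scalar \<open>1\<close>.
\<close>

section \<open>Unfolding the definitions\<close>

lemma linear_rules:
  assumes "Vector_Spaces.linear s t f"
  shows "f (x + y) = f x + f y" "f (s z x) = t z (f x)" "f (x - y) = f x - f y" "f 0 = 0"
proof -
  interpret Vector_Spaces.linear s t f by fact
  show "f (x + y) = f x + f y" "f (s z x) = t z (f x)" "f (x - y) = f x - f y" "f 0 = 0"
    by (rule add scale diff zero)+
qed

lemma conformal_module_rules:
  assumes "conformal_module M"
  shows "vector_space (scl M)" "Vector_Spaces.linear (scl M) (scl M) (der M)"
    "Vector_Spaces.linear (scl M) (scl M) (lact M l a)"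
    "der M (lact M l a v) - lact M l a (der M v) = scl M (- l) (lact M l a v)"
  using assms unfolding conformal_module_def by blast+

lemma cmod_hom_rules:
  assumes "cmod_hom M N f"
  shows "Vector_Spaces.linear (scl M) (scl N) f" "f (der M v) = der N (f v)"
    "f (lact M l a v) = lact N l a (f v)"
  using assms unfolding cmod_hom_def by blast+

lemma Vmod_Cmod_extension_rules:
  assumes "is_extension (Vmod \<alpha> \<Delta>) E (Cmod \<gamma>) i p"
  shows "conformal_module E" "inj i" "range i = {e. p e = 0}" "surj p"
    and "Vector_Spaces.linear smult (scl E) i" "i ([:0, 1:] * f) = der E (i f)"
      "i (lact (Vmod \<alpha> \<Delta>) l a f) = lact E l a (i f)"
    and "Vector_Spaces.linear (scl E) (*) p" "p (der E e) = \<gamma> * p e" "p (lact E l a e) = 0"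
proof -
  show "conformal_module E" "inj i" "range i = {e. p e = 0}" "surj p"
    using assms by (simp_all add: is_extension_def)
  have hi: "cmod_hom (Vmod \<alpha> \<Delta>) E i" and hp: "cmod_hom E (Cmod \<gamma>) p"
    using assms by (simp_all add: is_extension_def)
  show "Vector_Spaces.linear smult (scl E) i" "i ([:0, 1:] * f) = der E (i f)"
      "i (lact (Vmod \<alpha> \<Delta>) l a f) = lact E l a (i f)"
    using cmod_hom_rules(1)[OF hi] cmod_hom_rules(2)[OF hi, of f] cmod_hom_rules(3)[OF hi, of l a f]
    by (simp_all add: Vmod_def)
  show "Vector_Spaces.linear (scl E) (*) p" "p (der E e) = \<gamma> * p e" "p (lact E l a e) = 0"
    using cmod_hom_rules(1)[OF hp] cmod_hom_rules(2)[OF hp, of e] cmod_hom_rules(3)[OF hp, of l a e]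
    by (simp_all add: Cmod_def)
qed

lemma Emod_zero: "Emod \<alpha> \<Delta> \<gamma> 0 = direct_sum (Vmod \<alpha> \<Delta>) (Cmod \<gamma>)"
  by (simp add: Emod_def twisted_sum_def direct_sum_def)

section \<open>Normal form of an extension\<close>

text \<open>
  If \<open>\<partial>\<close> takes a lift of \<open>c\<^sub>\<gamma>\<close> to \<open>\<gamma>\<close> times itself plus \<open>g\<close>, subtracting from the lift the quotient
  of \<open>g\<close> by \<open>\<partial> - \<gamma>\<close> leaves only the remainder \<open>k = g(\<gamma>)\<close>.  Compatibility of the action with \<open>\<partial>\<close>
  then fixes the action on the lift and restricts the parameters when \<open>k \<noteq> 0\<close>.
\<close>

lemma extension_lift:
  assumes "is_extension (Vmod \<alpha> \<Delta>) E (Cmod \<gamma>) i p"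
  obtains c k where "p c = 1" "der E c = scl E \<gamma> c + i [:k:]"
    "\<And>l a. lact E l a c = i [:poly (fst a) (- l) * k:]"
    "k \<noteq> 0 \<longrightarrow> \<alpha> + \<gamma> = 0 \<and> \<Delta> = 1"
proof -
  let ?V = "Vmod \<alpha> \<Delta>"
  note ext_rules = Vmod_Cmod_extension_rules[OF assms]
  note E = ext_rules(1) and inj = ext_rules(2) and ker = ext_rules(3)
    and i = ext_rules(5-7) and p = ext_rules(8-10)
  interpret E: vector_space "scl E" by (rule conformal_module_rules[OF E])
  have derE: "Vector_Spaces.linear (scl E) (scl E) (der E)"
    and actE: "Vector_Spaces.linear (scl E) (scl E) (lact E l a)"
    and com: "der E (lact E l a e) - lact E l a (der E e) = scl E (- l) (lact E l a e)" for l a e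
    by (rule conformal_module_rules[OF E])+
  obtain c0 where c0: "p c0 = 1" using ext_rules(4) by (metis surjD)
  have "p (der E c0 - scl E \<gamma> c0) = 0"
    using c0 p(2) by (simp add: linear_rules[OF p(1)])
  then obtain g where g: "der E c0 - scl E \<gamma> c0 = i g" using ker by blast
  have "\<forall>l a. \<exists>f. lact E l a c0 = i f" using ker p(3) by blast
  then obtain F where F: "\<And>l a. lact E l a c0 = i (F l a)" by metis
  have d0: "der E c0 = scl E \<gamma> c0 + i g" using g by (simp add: algebra_simps)
  \<comment> \<open>The relation between \<open>a\<^sub>\<lambda>\<close> and \<open>\<partial>\<close> on \<open>c0\<close>, with \<open>i\<close> cancelled.\<close>
  have eq: "[:l - \<gamma>, 1:] * F l a = lact ?V l a g" for l a
  proof -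
    have "i ([:0, 1:] * F l a - smult \<gamma> (F l a) - lact ?V l a g) = i (smult (- l) (F l a))"
      unfolding linear_rules[OF i(1)] i(2,3)
      using com[of l a c0] unfolding F d0 linear_rules[OF actE] by (simp add: diff_diff_add)
    then have "[:0, 1:] * F l a - smult \<gamma> (F l a) - lact ?V l a g = smult (- l) (F l a)"
      using inj by (simp add: inj_eq)
    then show ?thesis by (simp add: algebra_simps smult_diff_left)
  qed
  define k where "k = poly g \<gamma>"
  \<comment> \<open>The factor \<open>\<partial> + \<lambda> - \<gamma>\<close> vanishes at \<open>\<gamma> - \<lambda>\<close>, where \<open>g(\<partial> + \<lambda>)\<close> takes the value \<open>g(\<gamma>)\<close>.\<close>
  have eqL: "k * (\<gamma> - l + \<alpha> + \<Delta> * l) = 0" for l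
  proof -
    have "poly (lact ?V l genL g) (\<gamma> - l) = 0"
      by (simp add: ring_distribs flip: eq)
    then show ?thesis
      by (simp add: Vmod_def genL_def poly_pcompose k_def algebra_simps)
  qed
  have k: "k \<noteq> 0 \<longrightarrow> \<alpha> + \<gamma> = 0 \<and> \<Delta> = 1"
  proof
    assume "k \<noteq> 0"
    then have "\<gamma> - l + \<alpha> + \<Delta> * l = 0" for l using eqL[of l] by simp
    from this[of 0] this[of 1] show "\<alpha> + \<gamma> = 0 \<and> \<Delta> = 1" by (simp add: algebra_simps)
  qed
  have \<gamma>: "\<gamma> = - \<alpha>" if "k \<noteq> 0" using k that by (simp add: eq_neg_iff_add_eq_0 add.commute)
  have "poly (g - [:k:]) \<gamma> = 0" by (simp add: k_def)
  then obtain h where "g - [:k:] = [:-\<gamma>, 1:] * h" by (metis poly_eq_0_iff_dvd dvdE)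
  then have gh: "g = [:k:] + [:-\<gamma>, 1:] * h" by (simp add: algebra_simps)
  \<comment> \<open>When \<open>k \<noteq> 0\<close>, the factors \<open>\<partial> + \<lambda> - \<gamma>\<close> and \<open>\<partial> + \<alpha> + \<Delta>\<lambda>\<close> coincide and cancel.\<close>
  have act: "F l a - lact ?V l a h = [:poly (fst a) (- l) * k:]" for l a
  proof -
    have "poly ([:l - \<gamma>, 1:] * (F l a - lact ?V l a h)) x
        = poly ([:l - \<gamma>, 1:] * [:poly (fst a) (- l) * k:]) x" for x
    proof -
      have "poly ([:l - \<gamma>, 1:] * (F l a - lact ?V l a h)) x
         = poly (lact ?V l a g) x - (l - \<gamma> + x) * poly (lact ?V l a h) x"
        unfolding right_diff_distrib eq by (simp add: algebra_simps)
      also have "\<dots> = poly (fst a) (- l) * k * (x + \<alpha> + \<Delta> * l)"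
        unfolding gh by (simp add: Vmod_def poly_pcompose algebra_simps)
      also have "\<dots> = poly ([:l - \<gamma>, 1:] * [:poly (fst a) (- l) * k:]) x"
        using k by (cases "k = 0") (simp_all add: \<gamma> algebra_simps)
      finally show ?thesis .
    qed
    then have "[:l - \<gamma>, 1:] * (F l a - lact ?V l a h) = [:l - \<gamma>, 1:] * [:poly (fst a) (- l) * k:]"
      by (intro poly_eq_poly_eq_iff[THEN iffD1] ext)
    then show ?thesis by (simp only: mult_cancel_left) simp
  qed
  show thesis
  proof (rule that[of "c0 - i h" k])
    have "p (i h) = 0" using ker by blast
    then show "p (c0 - i h) = 1" by (simp add: linear_rules[OF p(1)] c0)
    have "der E (c0 - i h) = scl E \<gamma> c0 + i (g - [:0, 1:] * h)"
      by (simp only: linear_rules[OF derE] linear_rules[OF i(1)] i(2) d0) simp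
    also have "g - [:0, 1:] * h = [:k:] - smult \<gamma> h" by (simp add: gh algebra_simps)
    finally show "der E (c0 - i h) = scl E \<gamma> (c0 - i h) + i [:k:]"
      by (simp add: linear_rules[OF i(1)] E.scale_right_diff_distrib)
    show "lact E l a (c0 - i h) = i [:poly (fst a) (- l) * k:]" for l a
      by (simp only: act[symmetric] linear_rules[OF actE] linear_rules[OF i(1)] F i(3))
  qed (rule k)
qed

text \<open>
  A lift of \<open>c\<^sub>\<gamma>\<close> splits the extension as a vector space; the coordinates of this splitting form the
  equivalence.
\<close>

lemma extension_equiv_Emod:
  assumes E_ext: "is_extension (Vmod \<alpha> \<Delta>) E (Cmod \<gamma>) i p"
  obtains k where "ext_equiv E i p (Emod \<alpha> \<Delta> \<gamma> k) incl snd"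
    "k \<noteq> 0 \<longrightarrow> \<alpha> + \<gamma> = 0 \<and> \<Delta> = 1"
proof -
  let ?V = "Vmod \<alpha> \<Delta>"
  note ext_rules = Vmod_Cmod_extension_rules[OF E_ext]
  note E = ext_rules(1) and inj = ext_rules(2) and ker = ext_rules(3)
    and i = ext_rules(5-7) and p = ext_rules(8-10)
  interpret E: vector_space "scl E" by (rule conformal_module_rules[OF E])
  have derE: "Vector_Spaces.linear (scl E) (scl E) (der E)"
    and actE: "\<And>l a. Vector_Spaces.linear (scl E) (scl E) (lact E l a)"
    by (rule conformal_module_rules[OF E])+
  obtain c k where c: "p c = 1" "der E c = scl E \<gamma> c + i [:k:]"
    "\<And>l a. lact E l a c = i [:poly (fst a) (- l) * k:]"
    "k \<noteq> 0 \<longrightarrow> \<alpha> + \<gamma> = 0 \<and> \<Delta> = 1"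
    using extension_lift[OF E_ext] by blast
  have "e - scl E (p e) c \<in> range i" for e
    by (simp add: ker linear_rules[OF p(1)] c(1))
  then have "\<forall>e. \<exists>v. i v = e - scl E (p e) c" by (metis imageE)
  then obtain r where r: "\<And>e. i (r e) = e - scl E (p e) c" by metis
  have re: "r e = v" if "e = i v + scl E (p e) c" for e v
  proof -
    have "i (r e) = i v" using that r[of e] by (metis add_diff_cancel_right')
    then show ?thesis using inj by (simp add: inj_eq)
  qed
  have split: "e = i (r e) + scl E (p e) c" for e by (simp add: r)
  have r_add: "r (e + e') = r e + r e'" for e e'
    by (rule re) (simp add: linear_rules[OF i(1)] linear_rules[OF p(1)] r E.scale_left_distrib)
  have r_scl: "r (scl E z e) = smult z (r e)" for z e
    by (rule re) (simp add: linear_rules[OF i(1)] linear_rules[OF p(1)] r E.scale_right_diff_distrib)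
  have p_i: "p (i v) = 0" for v using ker by blast
  have r_i: "r (i v) = v" for v by (rule re) (simp add: p_i)
  have r_der: "r (der E e) = [:0, 1:] * r e + smult (p e) [:k:]" for e
  proof (rule re)
    have "der E e = der E (i (r e) + scl E (p e) c)" using split[of e] by simp
    also have "\<dots> = i ([:0, 1:] * r e + smult (p e) [:k:]) + scl E (p (der E e)) c"
      by (simp only: linear_rules[OF derE] linear_rules[OF i(1)] i(2) c(2) p(2)
          E.scale_right_distrib E.scale_scale mult.commute[of "p e" \<gamma>] add_ac)
    finally show "der E e = i ([:0, 1:] * r e + smult (p e) [:k:]) + scl E (p (der E e)) c" .
  qed
  have r_act: "r (lact E l a e) = lact ?V l a (r e) + smult (p e) [:poly (fst a) (- l) * k:]" for l a e
  proof (rule re)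
    have "lact E l a e = lact E l a (i (r e) + scl E (p e) c)" using split[of e] by simp
    also have "\<dots> = i (lact ?V l a (r e) + smult (p e) [:poly (fst a) (- l) * k:]) + scl E (p (lact E l a e)) c"
      by (simp only: linear_rules[OF actE] linear_rules[OF i(1)] i(3) c(3) p(3) E.scale_zero_left add_0_right)
    finally show "lact E l a e
      = i (lact ?V l a (r e) + smult (p e) [:poly (fst a) (- l) * k:]) + scl E (p (lact E l a e)) c" .
  qed
  let ?\<psi> = "\<lambda>e. (r e, p e)"
  have vs: "vector_space (scl (Emod \<alpha> \<Delta> \<gamma> k))"
    by unfold_locales
      (auto simp: Emod_def twisted_sum_def Vmod_def Cmod_def algebra_simps smult_add_left smult_add_right)
  have "Vector_Spaces.linear (scl E) (scl (Emod \<alpha> \<Delta> \<gamma> k)) ?\<psi>"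
    by (rule linear_from_vector_space[OF E.vector_space_axioms vs])
      (simp_all add: r_add r_scl linear_rules[OF p(1)] Emod_def twisted_sum_def Vmod_def Cmod_def)
  moreover have "?\<psi> (der E e) = der (Emod \<alpha> \<Delta> \<gamma> k) (?\<psi> e)" for e
    by (simp add: r_der p(2) Emod_def twisted_sum_def Vmod_def Cmod_def)
  moreover have "?\<psi> (lact E l a e) = lact (Emod \<alpha> \<Delta> \<gamma> k) l a (?\<psi> e)" for l a e
    by (simp add: r_act p(3) Emod_def twisted_sum_def Cmod_def mult_ac)
  ultimately have "cmod_hom E (Emod \<alpha> \<Delta> \<gamma> k) ?\<psi>" by (simp add: cmod_hom_def)
  moreover have "?\<psi> \<circ> i = incl" by (rule ext) (simp add: r_i p_i incl_def)
  moreover have "snd \<circ> ?\<psi> = p" by auto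
  ultimately have "ext_equiv E i p (Emod \<alpha> \<Delta> \<gamma> k) incl snd" unfolding ext_equiv_def by blast
  then show thesis using that c(4) by blast
qed

lemma nontrivial_extension_equiv_Emod:
  assumes "is_extension (Vmod \<alpha> \<Delta>) E (Cmod \<gamma>) i p" "\<not> trivial_ext (Vmod \<alpha> \<Delta>) E (Cmod \<gamma>) i p"
  shows "\<alpha> + \<gamma> = 0" "\<Delta> = 1" "\<exists>k. k \<noteq> 0 \<and> ext_equiv E i p (Emod \<alpha> \<Delta> \<gamma> k) incl snd"
proof -
  obtain k where k: "ext_equiv E i p (Emod \<alpha> \<Delta> \<gamma> k) incl snd" "k \<noteq> 0 \<longrightarrow> \<alpha> + \<gamma> = 0 \<and> \<Delta> = 1"
    using extension_equiv_Emod[OF assms(1)] .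
  have "k \<noteq> 0" using k(1) assms(2) by (auto simp: Emod_zero trivial_ext_def)
  with k show "\<alpha> + \<gamma> = 0" "\<Delta> = 1" "\<exists>k. k \<noteq> 0 \<and> ext_equiv E i p (Emod \<alpha> \<Delta> \<gamma> k) incl snd" by auto
qed

section \<open>Cocycles and coboundaries\<close>

text \<open>
  A linear map compatible with \<open>incl\<close> and \<open>snd\<close> has the form \<open>(v, w) \<mapsto> (v + \<phi>(w), w)\<close>; the two
  conditions on \<open>\<phi>\<close> say that it commutes with the action and with \<open>\<partial>\<close>, that is, that the cochains
  differ by the coboundary of \<open>\<phi>\<close>.
\<close>

lemma ext_equiv_twisted_sum:
  fixes V :: "'v::ab_group_add cmod" and W :: "'w::ab_group_add cmod"
  assumes "vector_space (scl V)" "vector_space (scl W)"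
  shows "ext_equiv (twisted_sum V W \<omega>) incl snd (twisted_sum V W \<omega>') incl snd \<longleftrightarrow>
    (\<exists>\<phi>. Vector_Spaces.linear (scl W) (scl V) \<phi> \<and>
       (\<forall>l a v w. lact V l a v + fst \<omega> l a w + \<phi> (lact W l a w) = lact V l a (v + \<phi> w) + fst \<omega>' l a w) \<and>
       (\<forall>v w. der V v + snd \<omega> w + \<phi> (der W w) = der V (v + \<phi> w) + snd \<omega>' w))"
    (is "?L \<longleftrightarrow> ?R")
proof
  interpret V: vector_space "scl V" by fact
  let ?T = "twisted_sum V W"
  assume ?L
  then obtain \<psi> where \<psi>: "cmod_hom (?T \<omega>) (?T \<omega>') \<psi>" "\<psi> \<circ> incl = incl" "snd \<circ> \<psi> = snd"
    unfolding ext_equiv_def by blast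
  define \<phi> where "\<phi> w = fst (\<psi> (0, w))" for w
  have lin: "Vector_Spaces.linear (scl (?T \<omega>)) (scl (?T \<omega>')) \<psi>"
    and der: "\<And>e. \<psi> (der (?T \<omega>) e) = der (?T \<omega>') (\<psi> e)"
    and act: "\<And>l a e. \<psi> (lact (?T \<omega>) l a e) = lact (?T \<omega>') l a (\<psi> e)"
    by (rule cmod_hom_rules[OF \<psi>(1)])+
  have \<psi>0: "\<psi> (0, w) = (\<phi> w, w)" for w
    using fun_cong[OF \<psi>(3), of "(0, w)"] by (simp add: \<phi>_def prod_eq_iff)
  have \<psi>eq: "\<psi> (v, w) = (v + \<phi> w, w)" for v w
    using linear_rules(1)[OF lin, of "(v, 0)" "(0, w)"] fun_cong[OF \<psi>(2), of v]
    by (simp add: \<psi>0 incl_def)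
  have "\<phi> (w + w') = \<phi> w + \<phi> w'" for w w'
    using linear_rules(1)[OF lin, of "(0, w)" "(0, w')"] by (simp add: \<psi>0)
  moreover have "\<phi> (scl W z w) = scl V z (\<phi> w)" for z w
    using linear_rules(2)[OF lin, of z "(0, w)"] by (simp add: \<psi>0 twisted_sum_def)
  ultimately have "Vector_Spaces.linear (scl W) (scl V) \<phi>"
    by (intro linear_from_vector_space assms)
  moreover have "lact V l a v + fst \<omega> l a w + \<phi> (lact W l a w) = lact V l a (v + \<phi> w) + fst \<omega>' l a w"
    for l a v w
    using act[of l a "(v, w)"] by (simp add: twisted_sum_def \<psi>eq)
  moreover have "der V v + snd \<omega> w + \<phi> (der W w) = der V (v + \<phi> w) + snd \<omega>' w" for v w
    using der[of "(v, w)"] by (simp add: twisted_sum_def \<psi>eq)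
  ultimately show ?R by blast
next
  interpret V: vector_space "scl V" by fact
  interpret W: vector_space "scl W" by fact
  assume ?R
  then obtain \<phi> where \<phi>: "Vector_Spaces.linear (scl W) (scl V) \<phi>"
    "\<And>l a v w. lact V l a v + fst \<omega> l a w + \<phi> (lact W l a w) = lact V l a (v + \<phi> w) + fst \<omega>' l a w"
    "\<And>v w. der V v + snd \<omega> w + \<phi> (der W w) = der V (v + \<phi> w) + snd \<omega>' w"
    by blast
  have vs: "vector_space (scl (twisted_sum V W \<eta>))" for \<eta>
    by unfold_locales (auto simp: twisted_sum_def V.scale_right_distrib V.scale_left_distrib
        W.scale_right_distrib W.scale_left_distrib)
  have "cmod_hom (twisted_sum V W \<omega>) (twisted_sum V W \<omega>') (\<lambda>(v, w). (v + \<phi> w, w))"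
    unfolding cmod_hom_def
  proof (intro conjI allI linear_from_vector_space vs)
  qed (auto simp: twisted_sum_def \<phi>(2,3) linear_rules[OF \<phi>(1)] V.scale_right_distrib)
  then show ?L unfolding ext_equiv_def
    by (intro exI[of _ "\<lambda>(v, w). (v + \<phi> w, w)"]) (auto simp: incl_def linear_rules[OF \<phi>(1)])
qed

text \<open>
  The cochain of the standard extension with scalar \<open>k\<close> plus the coboundary of the linear map \<open>1 \<mapsto> h\<close>
  from \<open>\<complex>c\<^sub>-\<^sub>\<alpha>\<close> to \<open>V(\<alpha>,1)\<close>.
\<close>

definition ext_cocycle :: "complex \<Rightarrow> complex \<Rightarrow> complex poly \<Rightarrow> (complex poly, complex) cochain" where
  "ext_cocycle \<alpha> k h =
     ((\<lambda>l a z. smult (poly (fst a) (- l) * z) ([:k:] + pcompose h [:l, 1:] * [:\<alpha> + l, 1:])),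
      (\<lambda>z. smult z ([:k:] + [:\<alpha>, 1:] * h)))"

lemma ext_equiv_ext_cocycle_iff:
  "ext_equiv (twisted_sum (Vmod \<alpha> 1) (Cmod (- \<alpha>)) \<omega>) incl snd
             (twisted_sum (Vmod \<alpha> 1) (Cmod (- \<alpha>)) (ext_cocycle \<alpha> k 0)) incl snd
     \<longleftrightarrow> (\<exists>h. \<omega> = ext_cocycle \<alpha> k h)"
proof -
  have vsV: "vector_space (scl (Vmod \<alpha> 1))" and vsW: "vector_space (scl (Cmod (- \<alpha>)))"
    by (intro conformal_module_rules conformal_module_Vmod conformal_module_Cmod)+
  have V: "lact (Vmod \<alpha> 1) l a (f + g) = lact (Vmod \<alpha> 1) l a f + lact (Vmod \<alpha> 1) l a g"
    "der (Vmod \<alpha> 1) (f + g) = der (Vmod \<alpha> 1) f + der (Vmod \<alpha> 1) g" for l a f g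
    by (simp_all only: linear_rules[OF conformal_module_rules(2)] linear_rules[OF conformal_module_rules(3)]
        conformal_module_Vmod)
  show ?thesis unfolding ext_equiv_twisted_sum[OF vsV vsW] V
  proof safe
    fix \<phi> assume lin: "Vector_Spaces.linear (scl (Cmod (- \<alpha>))) (scl (Vmod \<alpha> 1)) \<phi>"
      and 1: "\<forall>l a v w. lact (Vmod \<alpha> 1) l a v + fst \<omega> l a w + \<phi> (lact (Cmod (- \<alpha>)) l a w)
        = lact (Vmod \<alpha> 1) l a v + lact (Vmod \<alpha> 1) l a (\<phi> w) + fst (ext_cocycle \<alpha> k 0) l a w"
      and 2: "\<forall>v w. der (Vmod \<alpha> 1) v + snd \<omega> w + \<phi> (der (Cmod (- \<alpha>)) w)
        = der (Vmod \<alpha> 1) v + der (Vmod \<alpha> 1) (\<phi> w) + snd (ext_cocycle \<alpha> k 0) w"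
    have \<phi>: "\<phi> z = smult z (\<phi> 1)" for z
      using linear_rules(2)[OF lin, of z 1] by (simp add: Cmod_def Vmod_def)
    have \<phi>0: "\<phi> 0 = 0" by (rule linear_rules(4)[OF lin])
    have "fst \<omega> l a z = fst (ext_cocycle \<alpha> k (\<phi> 1)) l a z" for l a z
      using 1[rule_format, of l a 0 z]
      by (simp add: \<phi>0 Cmod_def Vmod_def ext_cocycle_def \<phi>[of z] pcompose_smult smult_add_right algebra_simps)
    moreover have "snd \<omega> z = snd (ext_cocycle \<alpha> k (\<phi> 1)) z" for z
      using 2[rule_format, of 0 z]
      by (simp add: Cmod_def Vmod_def ext_cocycle_def \<phi>[of z] \<phi>[of "- (\<alpha> * z)"] smult_add_right algebra_simps)
    ultimately have "\<omega> = ext_cocycle \<alpha> k (\<phi> 1)" by (intro prod_eqI ext)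
    then show "\<exists>h. \<omega> = ext_cocycle \<alpha> k h" ..
  next
    fix h
    show "\<exists>\<phi>. Vector_Spaces.linear (scl (Cmod (- \<alpha>))) (scl (Vmod \<alpha> 1)) \<phi> \<and>
       (\<forall>l a v w. lact (Vmod \<alpha> 1) l a v + fst (ext_cocycle \<alpha> k h) l a w + \<phi> (lact (Cmod (- \<alpha>)) l a w)
          = lact (Vmod \<alpha> 1) l a v + lact (Vmod \<alpha> 1) l a (\<phi> w) + fst (ext_cocycle \<alpha> k 0) l a w) \<and>
       (\<forall>v w. der (Vmod \<alpha> 1) v + snd (ext_cocycle \<alpha> k h) w + \<phi> (der (Cmod (- \<alpha>)) w)
          = der (Vmod \<alpha> 1) v + der (Vmod \<alpha> 1) (\<phi> w) + snd (ext_cocycle \<alpha> k 0) w)"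
      by (intro exI[of _ "\<lambda>z. smult z h"] conjI linear_from_vector_space[OF vsW vsV])
        (simp_all add: Cmod_def Vmod_def ext_cocycle_def pcompose_smult smult_add_right smult_add_left algebra_simps)
  qed
qed

lemma Emod_eq_ext_cocycle: "Emod \<alpha> 1 (- \<alpha>) k = twisted_sum (Vmod \<alpha> 1) (Cmod (- \<alpha>)) (ext_cocycle \<alpha> k 0)"
  by (simp add: Emod_def ext_cocycle_def mult_ac)

text \<open>
  The scalar is recovered as the value at \<open>-\<alpha>\<close> of the correction to \<open>\<partial>\<close>, since the coboundary part
  is a multiple of \<open>\<partial> + \<alpha>\<close>.
\<close>

lemma ext_cocycle_inject: "ext_cocycle \<alpha> k h = ext_cocycle \<alpha> k' h' \<Longrightarrow> k = k'"
proof -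
  assume "ext_cocycle \<alpha> k h = ext_cocycle \<alpha> k' h'"
  then have "poly (snd (ext_cocycle \<alpha> k h) 1) (- \<alpha>) = poly (snd (ext_cocycle \<alpha> k' h') 1) (- \<alpha>)" by simp
  then show "k = k'" by (simp add: ext_cocycle_def)
qed

text \<open>
  A pair of corrections is a cocycle as soon as the twisted sum satisfies the module axioms: exactness
  and compatibility with the two maps hold by construction.
\<close>

lemma is_extension_twisted_sum:
  assumes "conformal_module V" "conformal_module W" "conformal_module (twisted_sum V W \<omega>)"
  shows "is_extension V (twisted_sum V W \<omega>) W incl snd"
proof -
  let ?T = "twisted_sum V W \<omega>"
  have vs: "vector_space (scl V)" "vector_space (scl W)" "vector_space (scl ?T)"
    using assms by (simp_all add: conformal_module_rules)
  interpret W: vector_space "scl W" by (rule vs)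
  have W0: "der W 0 = 0" "lact W l a 0 = 0" for l a
    using assms(2) by (blast intro: linear_rules(4) conformal_module_rules)+
  have T0: "der ?T (v, 0) = (der V v, 0)" "lact ?T l a (v, 0) = (lact V l a v, 0)" for l a v
  proof -
    have "der ?T 0 = 0" "lact ?T l a 0 = 0" "der V 0 = 0" "lact V l a 0 = 0"
      using assms by (blast intro: linear_rules(4) conformal_module_rules)+
    then show "der ?T (v, 0) = (der V v, 0)" "lact ?T l a (v, 0) = (lact V l a v, 0)"
      by (simp_all add: twisted_sum_def zero_prod_def W0)
  qed
  have "cmod_hom V ?T incl"
    unfolding cmod_hom_def
    by (intro conjI allI linear_from_vector_space vs)
      (simp_all add: incl_def T0, simp add: twisted_sum_def)
  moreover have "cmod_hom ?T W snd"
    unfolding cmod_hom_def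
    by (intro conjI allI linear_from_vector_space vs)
      (auto simp: twisted_sum_def)
  moreover have "inj (incl :: 'a \<Rightarrow> 'a \<times> 'b)" "range (incl :: 'a \<Rightarrow> 'a \<times> 'b) = {e. snd e = 0}"
    by (auto simp: inj_def incl_def image_def)
  ultimately show ?thesis using assms by (simp add: is_extension_def)
qed

text \<open>
  On the twisted sum, \<open>(f, z) \<mapsto> (\<partial> + \<alpha>)(f + z h) + z k\<close> is a homomorphism to \<open>V(\<alpha>,0)\<close>, injective
  together with the projection to \<open>z\<close>; this is why the axioms hold.  They are checked directly, by
  comparing values of polynomials in \<open>\<partial>\<close>.
\<close>

lemma conformal_module_ext_cocycle:
  "conformal_module (twisted_sum (Vmod \<alpha> 1) (Cmod (- \<alpha>)) (ext_cocycle \<alpha> k h))"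
    (is "conformal_module ?T")
proof -
  have scl: "scl ?T z e = (smult z (fst e), z * snd e)" for z e
    by (cases e) (simp add: twisted_sum_def Vmod_def Cmod_def)
  have der: "der ?T e = ([:0, 1:] * fst e + smult (snd e) ([:k:] + [:\<alpha>, 1:] * h), - \<alpha> * snd e)" for e
    by (cases e) (simp add: twisted_sum_def Vmod_def Cmod_def ext_cocycle_def)
  have act: "lact ?T l a e = (smult (poly (fst a) (- l))
      (pcompose (fst e + smult (snd e) h) [:l, 1:] * [:\<alpha> + l, 1:] + [:snd e * k:]), 0)" for l a e
    by (cases e) (simp add: twisted_sum_def Vmod_def Cmod_def ext_cocycle_def pcompose_add pcompose_smult
        smult_add_right algebra_simps)
  have vs: "vector_space (scl ?T)"
    by unfold_locales (simp_all add: scl smult_add_right smult_add_left algebra_simps)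
  have eqI: "u = v" if "\<And>x. poly (fst u) x = poly (fst v) x" "snd u = snd v"
    for u v :: "complex poly \<times> complex"
    using that by (metis poly_eq_poly_eq_iff ext prod_eq_iff)
  have pol: "\<exists>N w. \<forall>l. lact ?T l a e = (\<Sum>n\<le>N. scl ?T (l ^ n) (w n))" for a e
  proof -
    let ?F = "\<lambda>l f \<beta>. smult (poly (fst a) (- l)) (pcompose f [:l, 1:] * [:\<beta> + 1 * l, 1:])"
    \<comment> \<open>The summand \<open>p(-\<lambda>) z k\<close> of the action is the difference of the actions of \<open>V(1,1)\<close> and
      \<open>V(0,1)\<close> on the constant \<open>z k\<close>, both polynomial in \<open>\<lambda>\<close>.\<close>
    define u where "u = [:snd e * k:]"
    obtain Q0 where Q0: "\<And>l. ?F l (fst e + smult (snd e) h) \<alpha> = poly Q0 [:l:]"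
      using polynomial_in_parameter by metis
    obtain Q1 where Q1: "\<And>l. ?F l u 1 = poly Q1 [:l:]" using polynomial_in_parameter by metis
    obtain Q2 where Q2: "\<And>l. ?F l u 0 = poly Q2 [:l:]" using polynomial_in_parameter by metis
    define Q where "Q = Q0 + Q1 - Q2"
    have "fst (lact ?T l a e) = poly Q [:l:]" for l
      unfolding Q_def poly_add poly_diff Q0[symmetric] Q1[symmetric] Q2[symmetric]
      by (rule poly_eq_poly_eq_iff[THEN iffD1], rule ext) (simp add: act u_def algebra_simps)
    moreover have "(\<Sum>n\<le>N. scl ?T (l ^ n) (f n, 0)) = (\<Sum>n\<le>N. smult (l ^ n) (f n), 0)" for N l f
      by (simp add: scl prod_eq_iff fst_sum snd_sum)
    ultimately have "lact ?T l a e = (\<Sum>n\<le>degree Q. scl ?T (l ^ n) (coeff Q n, 0))" for l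
      by (simp add: prod_eq_iff poly_eq_smult_sum act)
    then show ?thesis by (intro exI[of _ "degree Q"] exI[of _ "\<lambda>n. (coeff Q n, 0)"]) simp
  qed
  have br: "lact ?T l a (lact ?T m b e) - lact ?T m b (lact ?T l a e)
      = lact ?T (l + m) (lca_bracket l a b) e" for l m a b e
  proof (rule eqI)
    fix x
    have 1: "m + (l + x) = x + (l + m)" "l + (m + x) = x + (l + m)" "l + (- l - m) = - m"
      "l + m + x = x + (l + m)"
      by simp_all
    show "poly (fst (lact ?T l a (lact ?T m b e) - lact ?T m b (lact ?T l a e))) x
      = poly (fst (lact ?T (l + m) (lca_bracket l a b) e)) x"
      by (simp add: act lca_bracket_def Let_def poly_pcompose 1, algebra)
  qed (simp add: act)
  show ?thesis
    unfolding conformal_module_def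
  proof (intro conjI allI vs pol br)
    show "Vector_Spaces.linear (scl ?T) (scl ?T) (der ?T)"
      by (rule linear_from_vector_space[OF vs vs]; rule eqI)
        (simp_all add: der scl algebra_simps)
    show "Vector_Spaces.linear (scl ?T) (scl ?T) (lact ?T l a)" for l a
      by (rule linear_from_vector_space[OF vs vs]; rule eqI)
        (simp_all add: act scl poly_pcompose algebra_simps)
    show "Vector_Spaces.linear lca_scale (scl ?T) (\<lambda>a. lact ?T l a e)" for l e
      by (rule linear_from_vector_space[OF vector_space_lca vs]; rule eqI)
        (simp_all add: act scl lca_scale_def poly_pcompose algebra_simps)
    show "lact ?T l (lca_der a) e = scl ?T (- l) (lact ?T l a e)" for l a e
      by (rule eqI) (simp_all add: act scl lca_der_def)
    show "der ?T (lact ?T l a e) - lact ?T l a (der ?T e) = scl ?T (- l) (lact ?T l a e)" for l a e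
      by (rule eqI) (simp_all add: act der scl poly_pcompose algebra_simps)
  qed
qed

lemma is_extension_ext_cocycle:
  "is_extension (Vmod \<alpha> 1) (twisted_sum (Vmod \<alpha> 1) (Cmod (- \<alpha>)) (ext_cocycle \<alpha> k h)) (Cmod (- \<alpha>)) incl snd"
  by (intro is_extension_twisted_sum conformal_module_Vmod conformal_module_Cmod conformal_module_ext_cocycle)

lemma cocycles_eq: "cocycles (Cmod (- \<alpha>)) (Vmod \<alpha> 1) = {ext_cocycle \<alpha> k h | k h. True}"
proof (intro equalityI subsetI)
  fix \<omega> assume "\<omega> \<in> cocycles (Cmod (- \<alpha>)) (Vmod \<alpha> 1)"
  then have "is_extension (Vmod \<alpha> 1) (twisted_sum (Vmod \<alpha> 1) (Cmod (- \<alpha>)) \<omega>) (Cmod (- \<alpha>)) incl snd"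
    by (simp add: cocycles_def)
  from extension_equiv_Emod[OF this]
  show "\<omega> \<in> {ext_cocycle \<alpha> k h | k h. True}"
    unfolding Emod_eq_ext_cocycle ext_equiv_ext_cocycle_iff by blast
qed (auto simp: cocycles_def is_extension_ext_cocycle)

lemma trivial_twisted_sum_iff:
  "trivial_ext (Vmod \<alpha> 1) (twisted_sum (Vmod \<alpha> 1) (Cmod (- \<alpha>)) \<omega>) (Cmod (- \<alpha>)) incl snd
    \<longleftrightarrow> (\<exists>h. \<omega> = ext_cocycle \<alpha> 0 h)"
  unfolding trivial_ext_def Emod_zero[symmetric] Emod_eq_ext_cocycle by (rule ext_equiv_ext_cocycle_iff)

lemma coboundaries_eq: "coboundaries (Cmod (- \<alpha>)) (Vmod \<alpha> 1) = range (ext_cocycle \<alpha> 0)"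
  by (auto simp: coboundaries_def cocycles_eq trivial_twisted_sum_iff)

section \<open>The dimension of Ext\<close>

lemma ext_cocycle_add: "ext_cocycle \<alpha> k h + ext_cocycle \<alpha> k' h' = ext_cocycle \<alpha> (k + k') (h + h')"
proof (intro prod_eqI ext)
  fix l a z
  show "fst (ext_cocycle \<alpha> k h + ext_cocycle \<alpha> k' h') l a z = fst (ext_cocycle \<alpha> (k + k') (h + h')) l a z"
    by (rule poly_eq_poly_eq_iff[THEN iffD1], rule ext) (simp add: ext_cocycle_def poly_pcompose algebra_simps)
next
  fix z
  show "snd (ext_cocycle \<alpha> k h + ext_cocycle \<alpha> k' h') z = snd (ext_cocycle \<alpha> (k + k') (h + h')) z"
    by (rule poly_eq_poly_eq_iff[THEN iffD1], rule ext) (simp add: ext_cocycle_def algebra_simps)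
qed

lemma ext_cocycle_scale: "cochain_scale (Vmod \<alpha> 1) z (ext_cocycle \<alpha> k h) = ext_cocycle \<alpha> (z * k) (smult z h)"
  by (simp add: ext_cocycle_def cochain_scale_def Vmod_def fun_eq_iff pcompose_smult smult_add_right algebra_simps)

lemma ext_cocycle_zero: "ext_cocycle \<alpha> 0 0 = 0"
  by (simp add: ext_cocycle_def zero_prod_def fun_eq_iff)

text \<open>
  The class of a cocycle consists of all cocycles with the same scalar \<open>k\<close>, and so is \<open>k\<close> times the
  class of the cocycle with \<open>k = 1\<close>, \<open>h = 0\<close>.
\<close>

lemma Ext_dim_one: "Ext_dim (Cmod (- \<alpha>)) (Vmod \<alpha> 1) 1"
proof -
  let ?s = "cochain_scale (Vmod \<alpha> 1) :: complex \<Rightarrow> (complex poly, complex) cochain \<Rightarrow> _"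
  let ?Z = "{ext_cocycle \<alpha> k h | k h. True}" and ?B = "range (ext_cocycle \<alpha> 0)"
  have vs: "vector_space ?s"
    by unfold_locales
      (auto simp: cochain_scale_def Vmod_def prod_eq_iff fun_eq_iff smult_add_right smult_add_left)
  interpret vector_space ?s by (rule vs)
  have Z: "subspace ?Z"
    unfolding subspace_def
  proof (intro conjI ballI allI)
    show "0 \<in> ?Z" using ext_cocycle_zero[of \<alpha>, symmetric] by blast
    show "x + y \<in> ?Z" if "x \<in> ?Z" "y \<in> ?Z" for x y
      using that ext_cocycle_add by blast
    show "?s z x \<in> ?Z" if "x \<in> ?Z" for z x
      using that ext_cocycle_scale by blast
  qed
  have B: "subspace ?B"
    unfolding subspace_def
  proof (intro conjI ballI allI)
    show "0 \<in> ?B" by (metis ext_cocycle_zero rangeI)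
  qed (auto simp: ext_cocycle_add ext_cocycle_scale)
  have diff: "ext_cocycle \<alpha> k h - ext_cocycle \<alpha> k' h' = ext_cocycle \<alpha> (k - k') (h - h')" for k k' h h'
    by (simp add: diff_eq_eq ext_cocycle_add)
  have cls: "quot_rel ?Z ?B `` {ext_cocycle \<alpha> k h} = range (ext_cocycle \<alpha> k)" for k h
  proof (intro equalityI subsetI)
    fix \<omega> assume "\<omega> \<in> quot_rel ?Z ?B `` {ext_cocycle \<alpha> k h}"
    then obtain k' h' where \<omega>: "\<omega> = ext_cocycle \<alpha> k' h'" and "ext_cocycle \<alpha> k h - \<omega> \<in> ?B"
      unfolding quot_rel_def by blast
    then have "k - k' = 0" by (auto simp: diff dest: ext_cocycle_inject)
    with \<omega> show "\<omega> \<in> range (ext_cocycle \<alpha> k)" by simp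
  qed (auto simp: quot_rel_def diff)
  have range_inject: "k = k'" if "range (ext_cocycle \<alpha> k) = range (ext_cocycle \<alpha> k')" for k k'
    using that ext_cocycle_inject by (metis rangeE rangeI)
  have rep: "quot_rel ?Z ?B `` {\<Sum>i<1. ?s (u i) (ext_cocycle \<alpha> 1 0)} = range (ext_cocycle \<alpha> (u 0))"
    for u :: "nat \<Rightarrow> complex"
  proof -
    have "(\<Sum>i<1. ?s (u i) (ext_cocycle \<alpha> 1 0)) = ext_cocycle \<alpha> (u 0) 0" by (simp add: ext_cocycle_scale)
    then show ?thesis by (simp only: cls)
  qed
  have uniq: "\<exists>!u :: nat \<Rightarrow> complex. (\<forall>i\<ge>1. u i = 0) \<and>
      \<xi> = quot_rel ?Z ?B `` {\<Sum>i<1. ?s (u i) (ext_cocycle \<alpha> 1 0)}" if "\<xi> \<in> ?Z // quot_rel ?Z ?B" for \<xi>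
  proof -
    obtain \<omega> where "\<omega> \<in> ?Z" "\<xi> = quot_rel ?Z ?B `` {\<omega>}" using \<open>\<xi> \<in> _\<close> by (rule quotientE)
    then obtain k h where "\<xi> = quot_rel ?Z ?B `` {ext_cocycle \<alpha> k h}" by blast
    then have \<xi>: "\<xi> = range (ext_cocycle \<alpha> k)" by (simp only: cls)
    show ?thesis
    proof (rule ex1I[of _ "\<lambda>i. if i = 0 then k else 0"])
      fix u :: "nat \<Rightarrow> complex"
      assume u: "(\<forall>i\<ge>1. u i = 0) \<and> \<xi> = quot_rel ?Z ?B `` {\<Sum>i<1. ?s (u i) (ext_cocycle \<alpha> 1 0)}"
      then have "range (ext_cocycle \<alpha> k) = range (ext_cocycle \<alpha> (u 0))" by (simp only: \<xi> rep)
      then have "k = u 0" by (rule range_inject)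
      then show "u = (\<lambda>i. if i = 0 then k else 0)" using u by auto
    qed (unfold \<xi> rep, simp)
  qed
  have "?B \<subseteq> ?Z" by auto
  moreover have "ext_cocycle \<alpha> 1 0 \<in> ?Z" by auto
  ultimately show ?thesis
    unfolding Ext_dim_def quot_dim_def cocycles_eq coboundaries_eq
    using vs Z B uniq by (intro conjI exI[of _ "\<lambda>_. ext_cocycle \<alpha> 1 0"]) auto
qed

section \<open>The classification\<close>

lemma Emod_nontrivial_extension:
  assumes "c \<noteq> 0"
  shows "is_extension (Vmod \<alpha> 1) (Emod \<alpha> 1 (- \<alpha>) c) (Cmod (- \<alpha>)) incl snd"
    "\<not> trivial_ext (Vmod \<alpha> 1) (Emod \<alpha> 1 (- \<alpha>) c) (Cmod (- \<alpha>)) incl snd"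
  using assms unfolding Emod_eq_ext_cocycle trivial_twisted_sum_iff
  by (auto simp: is_extension_ext_cocycle dest: ext_cocycle_inject)

lemma Emod_action:
  "lact (Emod \<alpha> \<Delta> \<gamma> c) l genL (0, 1) = scl (Emod \<alpha> \<Delta> \<gamma> c) c (1, 0)"
  "lact (Emod \<alpha> \<Delta> \<gamma> c) l genI (0, 1) = 0"
  "der (Emod \<alpha> \<Delta> \<gamma> c) (0, 1) = scl (Emod \<alpha> \<Delta> \<gamma> c) \<gamma> (0, 1) + scl (Emod \<alpha> \<Delta> \<gamma> c) c (1, 0)"
  by (simp_all add: Emod_def twisted_sum_def Vmod_def Cmod_def genL_def genI_def one_pCons zero_prod_def)

theorem theorem4p5:
  fixes \<alpha> \<gamma> \<Delta> :: complex
  assumes "\<Delta> \<noteq> 0"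
  shows
    "((\<exists>(E :: (complex poly \<times> complex) cmod) i p.
          is_extension (Vmod \<alpha> \<Delta>) E (Cmod \<gamma>) i p \<and> \<not> trivial_ext (Vmod \<alpha> \<Delta>) E (Cmod \<gamma>) i p)
        \<longleftrightarrow> \<alpha> + \<gamma> = 0 \<and> \<Delta> = 1) \<and>
     (\<forall>(E :: 'e::ab_group_add cmod) i p.
          is_extension (Vmod \<alpha> \<Delta>) E (Cmod \<gamma>) i p \<and> \<not> trivial_ext (Vmod \<alpha> \<Delta>) E (Cmod \<gamma>) i p
        \<longrightarrow> \<alpha> + \<gamma> = 0 \<and> \<Delta> = 1) \<and>
     (\<alpha> + \<gamma> = 0 \<and> \<Delta> = 1 \<longrightarrow>
        Ext_dim (Cmod (- \<alpha>)) (Vmod \<alpha> 1) 1 \<and>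
        (\<forall>c. c \<noteq> 0 \<longrightarrow>
           is_extension (Vmod \<alpha> \<Delta>) (Emod \<alpha> \<Delta> \<gamma> c) (Cmod \<gamma>) incl snd \<and>
           \<not> trivial_ext (Vmod \<alpha> \<Delta>) (Emod \<alpha> \<Delta> \<gamma> c) (Cmod \<gamma>) incl snd \<and>
           (\<forall>l. lact (Emod \<alpha> \<Delta> \<gamma> c) l genL (0, 1) = scl (Emod \<alpha> \<Delta> \<gamma> c) c (1, 0)) \<and>
           (\<forall>l. lact (Emod \<alpha> \<Delta> \<gamma> c) l genI (0, 1) = 0) \<and>
           der (Emod \<alpha> \<Delta> \<gamma> c) (0, 1)
             = scl (Emod \<alpha> \<Delta> \<gamma> c) \<gamma> (0, 1) + scl (Emod \<alpha> \<Delta> \<gamma> c) c (1, 0)) \<and>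
        (\<forall>(E :: 'e cmod) i p.
           is_extension (Vmod \<alpha> \<Delta>) E (Cmod \<gamma>) i p \<and> \<not> trivial_ext (Vmod \<alpha> \<Delta>) E (Cmod \<gamma>) i p
           \<longrightarrow> (\<exists>c. c \<noteq> 0 \<and> ext_equiv E i p (Emod \<alpha> \<Delta> \<gamma> c) incl snd)))"
proof (intro conjI iffI impI allI; (elim exE conjE)?)
  have \<gamma>: "\<gamma> = - \<alpha>" if "\<alpha> + \<gamma> = 0" using that by (simp add: eq_neg_iff_add_eq_0 add.commute)
  show "\<alpha> + \<gamma> = 0" "\<Delta> = 1"
    if "is_extension (Vmod \<alpha> \<Delta>) E (Cmod \<gamma>) i p" "\<not> trivial_ext (Vmod \<alpha> \<Delta>) E (Cmod \<gamma>) i p"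
    for E :: "(complex poly \<times> complex) cmod" and i p
    by (rule nontrivial_extension_equiv_Emod[OF that])+
  show "\<alpha> + \<gamma> = 0" "\<Delta> = 1"
    if "is_extension (Vmod \<alpha> \<Delta>) E (Cmod \<gamma>) i p" "\<not> trivial_ext (Vmod \<alpha> \<Delta>) E (Cmod \<gamma>) i p"
    for E :: "'e cmod" and i p
    by (rule nontrivial_extension_equiv_Emod[OF that])+
  show "\<exists>c. c \<noteq> 0 \<and> ext_equiv E i p (Emod \<alpha> \<Delta> \<gamma> c) incl snd"
    if "is_extension (Vmod \<alpha> \<Delta>) E (Cmod \<gamma>) i p" "\<not> trivial_ext (Vmod \<alpha> \<Delta>) E (Cmod \<gamma>) i p"
    for E :: "'e cmod" and i p
    by (rule nontrivial_extension_equiv_Emod[OF that])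
  show "Ext_dim (Cmod (- \<alpha>)) (Vmod \<alpha> 1) 1" by (rule Ext_dim_one)
  show "is_extension (Vmod \<alpha> \<Delta>) (Emod \<alpha> \<Delta> \<gamma> c) (Cmod \<gamma>) incl snd"
    "\<not> trivial_ext (Vmod \<alpha> \<Delta>) (Emod \<alpha> \<Delta> \<gamma> c) (Cmod \<gamma>) incl snd"
    if "\<alpha> + \<gamma> = 0" "\<Delta> = 1" "c \<noteq> 0" for c
    using Emod_nontrivial_extension[OF that(3), of \<alpha>] that(2) \<gamma>[OF that(1)] by simp_all
  then show "\<exists>(E :: (complex poly \<times> complex) cmod) i p.
      is_extension (Vmod \<alpha> \<Delta>) E (Cmod \<gamma>) i p \<and> \<not> trivial_ext (Vmod \<alpha> \<Delta>) E (Cmod \<gamma>) i p"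
    if "\<alpha> + \<gamma> = 0" "\<Delta> = 1"
    by (intro exI[of _ "Emod \<alpha> \<Delta> \<gamma> 1"] exI[of _ incl] exI[of _ snd]) (simp add: that)
qed (rule Emod_action)+

end
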